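(* Let $\ell>0$ and consider full local computation of $\ell$ bits with harvesting time $t_e=1$, so that the required energy is $\epsilon_c=\xi\psi^3\ell^3$. Let $$r_{\max}=\sup\left\{r>0:\ \gamma_2Pr^{-\alpha}+\tfrac32\gamma_4P^2r^{-2\alpha}>\epsilon_c\right\}$$ be the maximum distance for deterministic fading, and let $$P_s(r)=\mathbb{P}\left(\gamma_2Pr^{-\alpha}|h|^2+\tfrac32\gamma_4P^2r^{-2\alpha}|h|^4>\epsilon_c\right)$$ be the success probability at distance $r>0$ under Rayleigh fading. Then $$r_{\max}^{\alpha}=\frac{P}{2\ell^3\xi\psi^3}\left(\gamma_2+\sqrt{\gamma_2^2+6\gamma_4\ell^3\xi\psi^3}\right),\qquad P_s(r)=\exp\left(\frac{r^{\alpha}\gamma_2}{3\gamma_4P}\left(1-\sqrt{1+\frac{6\gamma_4}{\gamma_2^2}\ell^3\xi\psi^3}\right)\right),$$ and for every $r>r_{\max}$ the success probability is non-zero and satisfies $P_s(r)<\exp(-1)$.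
   Context: $h\sim\mathcal{CN}(0,1)$ is a circularly symmetric complex Gaussian random variable, so $|h|^2$ is exponential with mean $1$ (Rayleigh fading); deterministic fading means $|h|=1$. The constants $P,\xi,\psi,\gamma_2,\gamma_4$ are positive reals and $\alpha>2$. The harvested energy at distance $r$ during unit time is $\gamma_2Pr^{-\alpha}|h|^2+\frac32\gamma_4P^2r^{-2\alpha}|h|^4$, and local computation of $\ell$ bits succeeds when this exceeds $\xi\psi^3\ell^3$. *)

theory Defs
  imports "HOL-Probability.Probability"
begin

text \<open>
  The circularly symmetric law \<open>CN(\<mu>, v)\<close> is given by its density with respect to Lebesgue measure
  on the complex plane. Here \<open>v\<close> is the total variance \<open>E |h - \<mu>|^2\<close>, so real and imaginary part are
  independent with variance \<open>v / 2\<close> each.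
\<close>

definition complex_normal_density :: "complex \<Rightarrow> real \<Rightarrow> complex \<Rightarrow> real" where
  "complex_normal_density \<mu> v z = exp (- (cmod (z - \<mu>))\<^sup>2 / v) / (pi * v)"

definition complex_normal_distributed ::
    "'a measure \<Rightarrow> ('a \<Rightarrow> complex) \<Rightarrow> complex \<Rightarrow> real \<Rightarrow> bool" where
  "complex_normal_distributed M h \<mu> v \<longleftrightarrow>
     distributed M lborel h (\<lambda>z. ennreal (complex_normal_density \<mu> v z))"

text \<open>The argument \<open>a\<close> is the fading amplitude \<open>|h|\<close>; the harvesting time is 1.\<close>

definition harvested_energy :: "real \<Rightarrow> real \<Rightarrow> real \<Rightarrow> real \<Rightarrow> real \<Rightarrow> real \<Rightarrow> real" where
  "harvested_energy \<gamma>2 \<gamma>4 P \<alpha> r a =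
     \<gamma>2 * P * r powr (- \<alpha>) * a ^ 2 + 3 / 2 * \<gamma>4 * P ^ 2 * r powr (- 2 * \<alpha>) * a ^ 4"

definition computation_energy :: "real \<Rightarrow> real \<Rightarrow> real \<Rightarrow> real" where
  "computation_energy \<xi> \<psi> l = \<xi> * \<psi> ^ 3 * l ^ 3"

definition r_max :: "real \<Rightarrow> real \<Rightarrow> real \<Rightarrow> real \<Rightarrow> real \<Rightarrow> real" where
  "r_max \<gamma>2 \<gamma>4 P \<alpha> \<epsilon> = Sup {r. r > 0 \<and> harvested_energy \<gamma>2 \<gamma>4 P \<alpha> r 1 > \<epsilon>}"

definition success_prob ::
    "'a measure \<Rightarrow> ('a \<Rightarrow> complex) \<Rightarrow> real \<Rightarrow> real \<Rightarrow> real \<Rightarrow> real \<Rightarrow> real \<Rightarrow> real \<Rightarrow> real" where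
  "success_prob M h \<gamma>2 \<gamma>4 P \<alpha> \<epsilon> r =
     measure M {\<omega> \<in> space M. harvested_energy \<gamma>2 \<gamma>4 P \<alpha> r (cmod (h \<omega>)) > \<epsilon>}"

end

theory Submission
  imports Defs
begin

text \<open>
  The energy is a strictly increasing quadratic \<open>q x = \<gamma>2 x + 3/2 \<gamma>4 x\<^sup>2\<close> in \<open>x = P r powr (- \<alpha>) |h|\<^sup>2\<close>. With \<open>x0\<close> the positive root of
  \<open>q x = \<epsilon>\<close>, success means \<open>|h|\<^sup>2 > x0 r\<^sup>\<alpha> / P\<close>, so \<open>r_max\<^sup>\<alpha> = P / x0\<close> and, \<open>|h|\<^sup>2\<close> being exponential,
  the success probability is \<open>exp (- (r / r_max)\<^sup>\<alpha>)\<close>.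
\<close>

lemma nn_integral_exp_minus_atLeast:
  "(\<integral>\<^sup>+u. ennreal (exp (- u)) * indicator {a..} u \<partial>lborel) = ennreal (exp (- a))"
proof -
  have lim: "((\<lambda>u::real. - exp (- u)) \<longlongrightarrow> 0) at_top"
    by real_asymp
  have "(\<integral>\<^sup>+u. ennreal (exp (- u)) * indicator {a..} u \<partial>lborel) = ennreal (0 - (- exp (- a)))"
    by (rule nn_integral_FTC_atLeast[OF _ _ _ lim]) (auto intro!: derivative_eq_intros)
  then show ?thesis by simp
qed

text \<open>The radial integral left over after the exchange of integrals: up to the factor
  \<open>pi\<close>, \<open>u - t\<close> is the area of an annulus. Integration by parts gives the
  antiderivative \<open>- ((u - t + 1) * exp (- u))\<close>.\<close>

lemma nn_integral_shifted_linear_exp_minus_atLeast: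
  "(\<integral>\<^sup>+u. ennreal ((u - t) * exp (- u)) * indicator {t..} u \<partial>lborel) = ennreal (exp (- t))"
proof -
  have lim: "((\<lambda>u::real. - ((u - t + 1) * exp (- u))) \<longlongrightarrow> 0) at_top"
    by real_asymp
  have "(\<integral>\<^sup>+u. ennreal ((u - t) * exp (- u)) * indicator {t..} u \<partial>lborel)
      = ennreal (0 - (- ((t - t + 1) * exp (- t))))"
    by (rule nn_integral_FTC_atLeast[OF _ _ _ lim])
      (auto intro!: derivative_eq_intros simp: algebra_simps)
  then show ?thesis by simp
qed

lemma emeasure_lborel_complex_cball:
  assumes "r \<ge> 0"
  shows "emeasure lborel (cball (c::complex) r) = ennreal (pi * r\<^sup>2)"
  using emeasure_cball[OF assms, of c] by (simp add: unit_ball_vol_2)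

text \<open>A difference of two closed discs. Strict inside and closed outside, the annulus fits
  both the strict tail event and the half-lines \<open>{(cmod z)^2..}\<close> of the layer-cake
  formula.\<close>

lemma emeasure_lborel_complex_annulus:
  assumes "0 \<le> t" "t \<le> u"
  shows "emeasure lborel {z::complex. t < (cmod z)\<^sup>2 \<and> (cmod z)\<^sup>2 \<le> u} = ennreal (pi * (u - t))"
proof -
  have sq: "(cmod z)\<^sup>2 \<le> s \<longleftrightarrow> cmod z \<le> sqrt s" for z s
    by (metis real_sqrt_le_iff real_sqrt_abs abs_norm_cancel)
  have "{z::complex. t < (cmod z)\<^sup>2 \<and> (cmod z)\<^sup>2 \<le> u} = cball 0 (sqrt u) - cball 0 (sqrt t)"
    using sq by (auto simp: not_le[symmetric])
  moreover have "emeasure lborel (cball (0::complex) (sqrt u) - cball 0 (sqrt t))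
      = emeasure lborel (cball (0::complex) (sqrt u)) - emeasure lborel (cball (0::complex) (sqrt t))"
    using assms by (intro emeasure_Diff)
      (auto simp: emeasure_lborel_complex_cball intro: order_trans[OF _ real_sqrt_le_mono])
  ultimately show ?thesis
    using assms by (simp add: emeasure_lborel_complex_cball ennreal_minus right_diff_distrib)
qed

text \<open>
  Layer-cake: \<open>exp (- |z|\<^sup>2)\<close> is the integral of \<open>exp (- u)\<close> over \<open>u \<ge> |z|\<^sup>2\<close>; exchanging the
  integrals leaves areas of annuli, which avoids polar coordinates.
\<close>

lemma nn_integral_exp_minus_cmod_square_tail:
  assumes "t \<ge> 0"
  shows "(\<integral>\<^sup>+z. ennreal (exp (- (cmod z)\<^sup>2)) * indicator {z. t < (cmod z)\<^sup>2} z \<partial>lborel)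
    = ennreal (pi * exp (- t))"
proof -
  let ?A = "\<lambda>u. {z::complex. t < (cmod z)\<^sup>2 \<and> (cmod z)\<^sup>2 \<le> u}"
  have "(\<integral>\<^sup>+z. ennreal (exp (- (cmod z)\<^sup>2)) * indicator {z. t < (cmod z)\<^sup>2} z \<partial>lborel)
      = (\<integral>\<^sup>+z. (\<integral>\<^sup>+u. ennreal (exp (- u)) * indicator {(cmod z)\<^sup>2..} u \<partial>lborel)
          * indicator {z. t < (cmod z)\<^sup>2} z \<partial>lborel)"
    by (simp add: nn_integral_exp_minus_atLeast)
  \<comment> \<open>The tail indicator does not depend on \<open>u\<close>, so it moves under the
    inner integral; the product of the two indicators is that of the annulus
    \<open>?A u\<close>.\<close>
  also have "\<dots> = (\<integral>\<^sup>+z. (\<integral>\<^sup>+u. ennreal (exp (- u)) * indicator (?A u) z \<partial>lborel) \<partial>lborel)"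
    by (subst nn_integral_multc[symmetric])
      (auto intro!: nn_integral_cong simp: indicator_def)
  also have "\<dots> = (\<integral>\<^sup>+u. (\<integral>\<^sup>+z. ennreal (exp (- u)) * indicator (?A u) z \<partial>lborel) \<partial>lborel)"
    by (rule lborel_pair.Fubini') (simp add: indicator_def, measurable)
  also have "\<dots> = (\<integral>\<^sup>+u. ennreal (exp (- u)) * emeasure lborel (?A u) \<partial>lborel)"
    by (intro nn_integral_cong nn_integral_cmult_indicator) auto
  also have "\<dots> = (\<integral>\<^sup>+u. ennreal pi * (ennreal ((u - t) * exp (- u)) * indicator {t..} u) \<partial>lborel)"
  proof (rule nn_integral_cong)
    fix u :: real
    show "ennreal (exp (- u)) * emeasure lborel (?A u)
        = ennreal pi * (ennreal ((u - t) * exp (- u)) * indicator {t..} u)"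
    proof (cases "t \<le> u")
      case True
      then show ?thesis
        using assms by (simp add: emeasure_lborel_complex_annulus ennreal_mult'[symmetric] mult_ac)
    next
      case False
      \<comment> \<open>The area formula covers only \<open>t \<le> u\<close>; below
        \<open>t\<close> both sides vanish.\<close>
      then have "?A u = {}" by auto
      then show ?thesis using False by (simp only: emeasure_empty) simp
    qed
  qed
  also have "\<dots> = ennreal (pi * exp (- t))"
    by (simp add: nn_integral_cmult nn_integral_shifted_linear_exp_minus_atLeast ennreal_mult)
  finally show ?thesis .
qed

text \<open>With mean 0 and total variance 1 the density is \<open>exp (- (cmod z)^2) / pi\<close>,
  whose \<open>1 / pi\<close> cancels the \<open>pi\<close> of the planar tail integral. This is the
  exponential law of mean 1.\<close>

lemma complex_normal_cmod_square_tail: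
  assumes "complex_normal_distributed M h 0 1" "t \<ge> 0"
  shows "measure M {\<omega> \<in> space M. (cmod (h \<omega>))\<^sup>2 > t} = exp (- t)"
proof -
  let ?B = "{z::complex. t < (cmod z)\<^sup>2}"
  have d: "distributed M lborel h (\<lambda>z. ennreal (complex_normal_density 0 1 z))"
    using assms(1) by (simp add: complex_normal_distributed_def)
  have "emeasure M (h -` ?B \<inter> space M)
      = (\<integral>\<^sup>+z. ennreal (complex_normal_density 0 1 z) * indicator ?B z \<partial>lborel)"
    by (rule distributed_emeasure[OF d]) simp
  also have "\<dots> = (\<integral>\<^sup>+z. ennreal (1 / pi) * (ennreal (exp (- (cmod z)\<^sup>2)) * indicator ?B z) \<partial>lborel)"
    by (simp add: complex_normal_density_def mult.assoc[symmetric] ennreal_mult'[symmetric])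
  also have "\<dots> = ennreal (exp (- t))"
    using assms(2) by (simp add: nn_integral_cmult nn_integral_exp_minus_cmod_square_tail
        ennreal_mult'[symmetric])
  moreover have "h -` ?B \<inter> space M = {\<omega> \<in> space M. (cmod (h \<omega>))\<^sup>2 > t}"
    by auto
  ultimately show ?thesis by (simp add: measure_def)
qed

text \<open>The root \<open>x0\<close>, read off the quadratic formula: the leading coefficient
  \<open>3 / 2 * \<gamma>4\<close> yields the discriminant under the square root and the denominator
  \<open>3 * \<gamma>4\<close>.\<close>

definition energy_root :: "real \<Rightarrow> real \<Rightarrow> real \<Rightarrow> real" where
  "energy_root \<gamma>2 \<gamma>4 \<epsilon> = (sqrt (\<gamma>2\<^sup>2 + 6 * \<gamma>4 * \<epsilon>) - \<gamma>2) / (3 * \<gamma>4)"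

lemma energy_root_pos:
  assumes "\<gamma>2 > 0" "\<gamma>4 > 0" "\<epsilon> > 0"
  shows "energy_root \<gamma>2 \<gamma>4 \<epsilon> > 0"
  using assms by (simp add: energy_root_def real_less_rsqrt)

lemma energy_root_eq:
  assumes "\<gamma>2 > 0" "\<gamma>4 > 0" "\<epsilon> > 0"
  shows "\<gamma>2 * energy_root \<gamma>2 \<gamma>4 \<epsilon> + 3 / 2 * \<gamma>4 * (energy_root \<gamma>2 \<gamma>4 \<epsilon>)\<^sup>2 = \<epsilon>"
proof -
  define S where "S = sqrt (\<gamma>2\<^sup>2 + 6 * \<gamma>4 * \<epsilon>)"
  have "S\<^sup>2 = \<gamma>2\<^sup>2 + 6 * \<gamma>4 * \<epsilon>"
    using assms by (simp add: S_def)
  then show ?thesis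
    unfolding energy_root_def S_def[symmetric] using assms
    by (simp add: field_simps power2_eq_square)
qed

text \<open>Subtracting the equation of the root leaves \<open>x - ?y\<close> times a factor that is
  positive because \<open>x \<ge> 0\<close>, so the sign is that of \<open>x - ?y\<close>.\<close>

lemma quadratic_gt_iff_energy_root_less:
  assumes "\<gamma>2 > 0" "\<gamma>4 > 0" "\<epsilon> > 0" "x \<ge> 0"
  shows "\<gamma>2 * x + 3 / 2 * \<gamma>4 * x\<^sup>2 > \<epsilon> \<longleftrightarrow> x > energy_root \<gamma>2 \<gamma>4 \<epsilon>"
proof -
  let ?y = "energy_root \<gamma>2 \<gamma>4 \<epsilon>"
  have "\<gamma>2 * x + 3 / 2 * \<gamma>4 * x\<^sup>2 - \<epsilon> = (x - ?y) * (\<gamma>2 + 3 / 2 * \<gamma>4 * (x + ?y))"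
    by (subst energy_root_eq[OF assms(1-3), symmetric]) (simp add: field_simps power2_eq_square)
  moreover have "\<gamma>2 + 3 / 2 * \<gamma>4 * (x + ?y) > 0"
    using assms energy_root_pos[OF assms(1-3)] by (simp add: add_pos_nonneg)
  ultimately show ?thesis
    by (metis diff_gt_0_iff_gt zero_less_mult_pos2 mult_pos_pos)
qed

text \<open>Substituting \<open>x = P * a^2 / r powr \<alpha>\<close> reduces the claim to the
  quadratic. The amplitude stays general: \<open>a = 1\<close> serves \<open>r_max\<close>, and
  \<open>a = cmod (h \<omega>)\<close> the success probability.\<close>

lemma harvested_energy_gt_iff:
  assumes "\<gamma>2 > 0" "\<gamma>4 > 0" "P > 0" "\<epsilon> > 0" "r > 0"
  shows "harvested_energy \<gamma>2 \<gamma>4 P \<alpha> r a > \<epsilon> \<longleftrightarrow> a\<^sup>2 > energy_root \<gamma>2 \<gamma>4 \<epsilon> * r powr \<alpha> / P"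
proof -
  define x where "x = P * a\<^sup>2 / r powr \<alpha>"
  have "r powr (- 2 * \<alpha>) = (r powr (- \<alpha>))\<^sup>2"
    using assms(5) by (simp add: power2_eq_square powr_add[symmetric])
  then have "harvested_energy \<gamma>2 \<gamma>4 P \<alpha> r a = \<gamma>2 * x + 3 / 2 * \<gamma>4 * x\<^sup>2"
    by (simp add: harvested_energy_def x_def powr_minus_divide power_mult_distrib power_divide)
  moreover have "x > energy_root \<gamma>2 \<gamma>4 \<epsilon> \<longleftrightarrow> a\<^sup>2 > energy_root \<gamma>2 \<gamma>4 \<epsilon> * r powr \<alpha> / P"
    using assms by (simp add: x_def field_simps)
  ultimately show ?thesis
    using quadratic_gt_iff_energy_root_less[of \<gamma>2 \<gamma>4 \<epsilon> x] assms by (simp add: x_def)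
qed

lemma r_max_eq:
  assumes "\<gamma>2 > 0" "\<gamma>4 > 0" "P > 0" "\<epsilon> > 0" "\<alpha> > 0"
  shows "r_max \<gamma>2 \<gamma>4 P \<alpha> \<epsilon> = (P / energy_root \<gamma>2 \<gamma>4 \<epsilon>) powr (1 / \<alpha>)"
proof -
  let ?y = "energy_root \<gamma>2 \<gamma>4 \<epsilon>"
  define R where "R = (P / ?y) powr (1 / \<alpha>)"
  have y: "?y > 0" using assms by (intro energy_root_pos)
  have R: "R > 0" "R powr \<alpha> = P / ?y"
    using y assms by (simp_all add: R_def powr_powr)
  have "harvested_energy \<gamma>2 \<gamma>4 P \<alpha> r 1 > \<epsilon> \<longleftrightarrow> r < R" if "r > 0" for r
  proof -
    have "harvested_energy \<gamma>2 \<gamma>4 P \<alpha> r 1 > \<epsilon> \<longleftrightarrow> r powr \<alpha> < R powr \<alpha>"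
      using harvested_energy_gt_iff[of \<gamma>2 \<gamma>4 P \<epsilon> r \<alpha> 1] assms that y
      by (simp add: R field_simps)
    also have "\<dots> \<longleftrightarrow> r < R"
      using that R assms by (meson less_imp_le not_less powr_less_mono2 powr_mono2)
    finally show ?thesis .
  qed
  \<comment> \<open>As \<open>R > 0\<close>, this interval is non-empty and its supremum is
    \<open>R\<close>.\<close>
  then have "{r. r > 0 \<and> harvested_energy \<gamma>2 \<gamma>4 P \<alpha> r 1 > \<epsilon>} = {0<..<R}"
    by auto
  then show ?thesis
    using R by (simp add: r_max_def R_def[symmetric])
qed

lemma success_prob_eq:
  assumes "complex_normal_distributed M h 0 1"
    and "\<gamma>2 > 0" "\<gamma>4 > 0" "P > 0" "\<epsilon> > 0" "r > 0"
  shows "success_prob M h \<gamma>2 \<gamma>4 P \<alpha> \<epsilon> r = exp (- (energy_root \<gamma>2 \<gamma>4 \<epsilon> * r powr \<alpha> / P))"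
  using complex_normal_cmod_square_tail[OF assms(1), of "energy_root \<gamma>2 \<gamma>4 \<epsilon> * r powr \<alpha> / P"]
    energy_root_pos[of \<gamma>2 \<gamma>4 \<epsilon>] assms
  by (simp add: success_prob_def harvested_energy_gt_iff)

theorem mainTheorem4:
  fixes M :: "'a measure" and h :: "'a \<Rightarrow> complex"
    and P \<xi> \<psi> \<gamma>2 \<gamma>4 \<alpha> l \<epsilon> :: real
  assumes "prob_space M"
    and "complex_normal_distributed M h 0 1"
    and "P > 0" and "\<xi> > 0" and "\<psi> > 0" and "\<gamma>2 > 0" and "\<gamma>4 > 0"
    and "\<alpha> > 2" and "l > 0"
    and "\<epsilon> = computation_energy \<xi> \<psi> l"
  shows "r_max \<gamma>2 \<gamma>4 P \<alpha> \<epsilon> powr \<alpha> =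
           P / (2 * l ^ 3 * \<xi> * \<psi> ^ 3) * (\<gamma>2 + sqrt (\<gamma>2 ^ 2 + 6 * \<gamma>4 * l ^ 3 * \<xi> * \<psi> ^ 3)) \<and>
         (\<forall>r>0. success_prob M h \<gamma>2 \<gamma>4 P \<alpha> \<epsilon> r =
           exp (r powr \<alpha> * \<gamma>2 / (3 * \<gamma>4 * P) *
             (1 - sqrt (1 + 6 * \<gamma>4 / \<gamma>2 ^ 2 * l ^ 3 * \<xi> * \<psi> ^ 3)))) \<and>
         (\<forall>r > r_max \<gamma>2 \<gamma>4 P \<alpha> \<epsilon>.
           success_prob M h \<gamma>2 \<gamma>4 P \<alpha> \<epsilon> r \<noteq> 0 \<and> success_prob M h \<gamma>2 \<gamma>4 P \<alpha> \<epsilon> r < exp (- 1))"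
proof -
  let ?y = "energy_root \<gamma>2 \<gamma>4 \<epsilon>"
  let ?R = "r_max \<gamma>2 \<gamma>4 P \<alpha> \<epsilon>"
  define S where "S = sqrt (\<gamma>2\<^sup>2 + 6 * \<gamma>4 * \<epsilon>)"
  have \<epsilon>: "\<epsilon> = l ^ 3 * \<xi> * \<psi> ^ 3" and \<epsilon>_pos: "\<epsilon> > 0"
    using assms by (simp_all add: computation_energy_def)
  have y: "?y > 0"
    using assms \<epsilon>_pos by (intro energy_root_pos)
  have y_S: "?y = (S - \<gamma>2) / (3 * \<gamma>4)"
    by (simp add: energy_root_def S_def)
  have S_sq: "S\<^sup>2 = \<gamma>2\<^sup>2 + 6 * \<gamma>4 * \<epsilon>"
    using assms \<epsilon>_pos by (simp add: S_def)
  have R: "?R = (P / ?y) powr (1 / \<alpha>)"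
    using assms \<epsilon>_pos by (intro r_max_eq) auto
  have R_pos: "?R > 0" and R_powr: "?R powr \<alpha> = P / ?y"
    using y assms(3,8) by (simp_all add: R powr_powr)
  have prob: "success_prob M h \<gamma>2 \<gamma>4 P \<alpha> \<epsilon> r = exp (- (?y * r powr \<alpha> / P))" if "r > 0" for r
    using assms \<epsilon>_pos that by (intro success_prob_eq) auto
  \<comment> \<open>Rationalising: multiplying \<open>3 * \<gamma>4 * P / (S - \<gamma>2)\<close>
    above and below by \<open>\<gamma>2 + S\<close> makes the denominator
    \<open>6 * \<gamma>4 * \<epsilon>\<close>.\<close>
  have "P / ?y = P / (2 * \<epsilon>) * (\<gamma>2 + S)"
  proof -
    have "S - \<gamma>2 > 0"
      using y assms(7) unfolding y_S by (simp add: zero_less_divide_iff)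
    moreover have "(S - \<gamma>2) * (\<gamma>2 + S) = 6 * \<gamma>4 * \<epsilon>"
      using S_sq by (simp add: algebra_simps power2_eq_square)
    ultimately show ?thesis
      using assms(7) \<epsilon>_pos by (simp add: y_S divide_simps) (simp add: algebra_simps)
  qed
  then have "?R powr \<alpha> =
      P / (2 * l ^ 3 * \<xi> * \<psi> ^ 3) * (\<gamma>2 + sqrt (\<gamma>2 ^ 2 + 6 * \<gamma>4 * l ^ 3 * \<xi> * \<psi> ^ 3))"
    unfolding R_powr S_def by (simp add: \<epsilon> mult.assoc)
  moreover have "success_prob M h \<gamma>2 \<gamma>4 P \<alpha> \<epsilon> r =
      exp (r powr \<alpha> * \<gamma>2 / (3 * \<gamma>4 * P) * (1 - sqrt (1 + 6 * \<gamma>4 / \<gamma>2 ^ 2 * l ^ 3 * \<xi> * \<psi> ^ 3)))"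
    if "r > 0" for r
  proof -
    \<comment> \<open>Pulling \<open>\<gamma>2\<close> out of the square root turns the stated
      exponent into \<open>- (?y * r powr \<alpha> / P)\<close>.\<close>
    have "1 + 6 * \<gamma>4 / \<gamma>2 ^ 2 * l ^ 3 * \<xi> * \<psi> ^ 3 = (S / \<gamma>2)\<^sup>2"
      using assms(6) by (simp add: power_divide S_sq \<epsilon> field_simps)
    moreover have "S / \<gamma>2 \<ge> 0"
      using assms \<epsilon>_pos by (simp add: S_def)
    ultimately have "sqrt (1 + 6 * \<gamma>4 / \<gamma>2 ^ 2 * l ^ 3 * \<xi> * \<psi> ^ 3) = S / \<gamma>2"
      by (simp only: real_sqrt_unique)
    then show ?thesis
      using assms(3,6,7) by (simp add: prob[OF that] y_S field_simps)
  qed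
  moreover have "success_prob M h \<gamma>2 \<gamma>4 P \<alpha> \<epsilon> r \<noteq> 0 \<and> success_prob M h \<gamma>2 \<gamma>4 P \<alpha> \<epsilon> r < exp (- 1)"
    if "r > ?R" for r
  proof -
    \<comment> \<open>Beyond \<open>?R\<close> the quantity \<open>?y * r powr \<alpha> / P\<close>
      exceeds 1, which puts the probability below \<open>exp (- 1)\<close>; as an exponential it is
      never zero.\<close>
    have "P / ?y < r powr \<alpha>"
      using that R_pos assms(8) by (simp add: R_powr[symmetric] powr_less_mono2)
    then show ?thesis
      using that R_pos y assms(3) by (simp add: prob field_simps)
  qed
  ultimately show ?thesis by blast
qed

end
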